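(* Let $R$ be a unital ring with involution $*$, let $a\in R$ and let $n$ be a positive integer. Then the following conditions are equivalent: (1) $a\in R^{\dagger}$; (2) there exists a projection $w\in R$ such that $aw=a$ and $w$ is a multiple of $(a^{*}a)^{n}$; (3) there exists a Hermite element $u\in R$ such that $au=a$ and $u$ is a right multiple of $(a^{*}a)^{n}$; (4) there exists a Hermite element $v\in R$ such that $av=a$ and $v$ is a left multiple of $(a^{*}a)^{n}$; (5) there exists $c\in R$ such that $ac=a$ and $c$ is a right multiple of $(a^{*}a)^{n}$.
   Context: $R$ is a unital ring with an involution $a\mapsto a^*$, i.e. $(a^* )^*=a$, $(ab)^*=b^*a^*$, $(a+b)^*=a^*+b^*$. $R^{\dagger}$ is the set of Moore-Penrose invertible elements, i.e. those $a$ for which there is $b\in R$ with $aba=a$, $bab=b$, $(ab)^*=ab$, $(ba)^*=ba$. A projection is an element $p$ with $p^2=p=p^*$; a Hermite element is an element $q$ with $q^*=q$. For $c,d\in R$: $c$ is a left multiple of $d$ if $c\in Rd=\{xd\mid x\in R\}$; a right multiple of $d$ if $c\in dR=\{dx\mid x\in R\}$; a multiple of $d$ if $c\in Rd\cap dR$. *)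

theory Defs
  imports Main
begin

text \<open>The library class \<^class>\<open>ring_1\<close> postulates \<open>0 \<noteq> 1\<close>; combining
  \<^class>\<open>ring\<close> with \<^class>\<open>monoid_mult\<close> gives unital rings including the zero ring.\<close>

class involution_ring = ring + monoid_mult +
  fixes star :: "'a \<Rightarrow> 'a"
  assumes star_star: "star (star a) = a"
    and star_mult: "star (a * b) = star b * star a"
    and star_add: "star (a + b) = star a + star b"

context involution_ring
begin

definition MP_invertible :: "'a set" where
  "MP_invertible = {a. \<exists>b. a * b * a = a \<and> b * a * b = b \<and>
     star (a * b) = a * b \<and> star (b * a) = b * a}"

definition projection :: "'a \<Rightarrow> bool" where
  "projection p \<longleftrightarrow> p\<^sup>2 = p \<and> star p = p"

definition Hermite :: "'a \<Rightarrow> bool" where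
  "Hermite q \<longleftrightarrow> star q = q"

definition left_multiple :: "'a \<Rightarrow> 'a \<Rightarrow> bool" where
  "left_multiple c d \<longleftrightarrow> c \<in> {x * d | x. True}"

definition right_multiple :: "'a \<Rightarrow> 'a \<Rightarrow> bool" where
  "right_multiple c d \<longleftrightarrow> c \<in> {d * x | x. True}"

definition multiple :: "'a \<Rightarrow> 'a \<Rightarrow> bool" where
  "multiple c d \<longleftrightarrow> c \<in> {x * d | x. True} \<inter> {d * x | x. True}"

end

end

theory Submission
  imports Defs
begin

text \<open>
  Write \<open>s = a\<^sup>* a\<close>. All the conditions say that \<open>s\<close> is invertible in a corner \<open>p R p\<close>,
  where \<open>p\<close> is a projection with \<open>a p = a\<close>.

  If \<open>b\<close> is the Moore-Penrose inverse of \<open>a\<close>, then the corner is cut out by \<open>p = b a\<close>, and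
  \<open>h = b b\<^sup>*\<close> is the inverse of \<open>s\<close> in it: \<open>s h = h s = p\<close>. Taking powers gives
  \<open>s\<^sup>n h\<^sup>n = h\<^sup>n s\<^sup>n = p\<close>, so that \<open>p\<close> is a multiple of \<open>s\<^sup>n\<close> from both sides. This is the
  strongest of the other conditions. Each of them implies the weakest, the equation
  \<open>a s\<^sup>n x = a\<close>, because the involution turns a Hermite left multiple of \<open>s\<^sup>n\<close> into a right
  multiple.

  Conversely, that equation has the form \<open>a s y = a\<close>. The factorization
  \<open>s = a\<^sup>* a\<close> then does the work: \<open>p = s y\<close> satisfies
  \<open>p\<^sup>* p = y\<^sup>* a\<^sup>* (a p) = y\<^sup>* a\<^sup>* a = p\<^sup>*\<close>, so it is a projection,
  and \<open>h = p y p\<close> is an inverse of \<open>s\<close> in \<open>p R p\<close>. The Moore-Penrose inverse of \<open>a\<close> is then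
  \<open>h a\<^sup>*\<close>, in analogy with the formula \<open>(a\<^sup>* a)\<^sup>-\<^sup>1 a\<^sup>*\<close> for an injective matrix \<open>a\<close>.
\<close>

context involution_ring
begin

lemma star_one: "star 1 = 1"
proof -
  have "star 1 = star (star 1 * 1)"
    by (metis mult_1_right star_mult star_star)
  then show ?thesis
    by (simp add: star_star)
qed

lemma star_power: "star (x ^ n) = star x ^ n"
  by (induction n) (simp_all add: star_one star_mult power_commutes)

lemma star_gram: "star (star a * a) = star a * a"
  by (simp add: star_mult star_star)

text \<open>The inner factor \<open>s\<^sup>n h\<^sup>n = w\<close> of \<open>s\<^sup>n\<^sup>+\<^sup>1 h\<^sup>n\<^sup>+\<^sup>1\<close> may be written \<open>h s\<close>, which leaves
  \<open>(s h) (s h) = w\<close>.\<close>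

lemma power_mult_power_eq_idempotent:
  assumes "s * h = w" "h * s = w" "w * w = w" "n > 0"
  shows "s ^ n * h ^ n = w"
  using \<open>n > 0\<close>
proof (induction n rule: nat_induct_non_zero)
  case 1
  then show ?case by (simp add: assms)
next
  case (Suc n)
  have "s ^ Suc n * h ^ Suc n = s * (s ^ n * h ^ n) * h"
    by (metis mult.assoc power_Suc power_Suc2)
  also have "\<dots> = (s * h) * (s * h)"
    by (metis Suc.IH assms(2) mult.assoc)
  finally show ?case by (simp add: assms)
qed

text \<open>The projection is \<open>b a\<close> for the Moore-Penrose inverse \<open>b\<close>; the cofactors come from
  \<open>b b\<^sup>*\<close> inverting \<open>a\<^sup>* a\<close> relative to it.\<close>

lemma MP_invertible_imp_projection_multiple:
  assumes "a \<in> MP_invertible" "n > 0"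
  obtains w where "projection w" "a * w = a" "multiple w ((star a * a) ^ n)"
proof -
  from assms obtain b where b: "a * b * a = a" "b * a * b = b"
    "star (a * b) = a * b" "star (b * a) = b * a"
    unfolding MP_invertible_def by blast
  define s h w where "s = star a * a" and "h = b * star b" and "w = b * a"
  have idem: "w * w = w"
    unfolding w_def by (metis b(2) mult.assoc)
  have "s * h = star a * star (a * b) * star b"
    unfolding s_def h_def by (simp add: b(3) mult.assoc)
  also have "\<dots> = star (b * (a * b * a))"
    by (simp add: star_mult mult.assoc)
  finally have sh: "s * h = w"
    by (simp add: b(1,4) w_def)
  \<comment> \<open>Both \<open>s\<close> and \<open>h\<close> are Hermite, so the involution swaps the factors.\<close>
  have hs: "h * s = w"
  proof -
    have "h * s = star (s * h)"
      unfolding s_def h_def by (simp add: star_mult star_star mult.assoc)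
    then show ?thesis by (simp add: sh w_def b(4))
  qed
  have "s ^ n * h ^ n = w" "h ^ n * s ^ n = w"
    using power_mult_power_eq_idempotent[OF sh hs idem assms(2)]
      power_mult_power_eq_idempotent[OF hs sh idem assms(2)] by auto
  then have "multiple w (s ^ n)"
    unfolding multiple_def by (blast intro: sym)
  moreover have "projection w"
    unfolding projection_def using idem by (simp add: power2_eq_square w_def b(4))
  moreover have "a * w = a"
    using b(1) by (simp add: w_def mult.assoc)
  ultimately show thesis
    using that unfolding s_def by blast
qed

text \<open>Here \<open>y\<close> inverts \<open>a\<^sup>* a\<close> only from the right and only up to \<open>p = a\<^sup>* a y\<close>. Since
  \<open>p\<close> turns out to be a projection, compressing \<open>y\<close> to the corner of \<open>p\<close> makes it a two-sided
  inverse \<open>h\<close> of \<open>a\<^sup>* a\<close> there, which forces \<open>h\<close> to be Hermite.\<close>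

lemma MP_invertible_if_gram_cancel:
  assumes "a * (star a * a * y) = a"
  shows "a \<in> MP_invertible"
proof -
  define s p where "s = star a * a" and "p = s * y"
  have ap: "a * p = a"
    using assms by (simp add: p_def s_def)
  have star_s: "star s = s"
    by (simp add: s_def star_gram)
  have star_p: "star p = star y * s"
    by (simp add: p_def star_mult star_s)
  have "star p * p = star p"
    unfolding star_p s_def by (simp add: mult.assoc ap)
  then have herm: "star p = p" and idem: "p * p = p"
    by (metis star_mult star_star)+
  have pa: "p * star a = star a"
    using arg_cong[OF ap, of star] by (simp add: star_mult herm)
  have sp: "s * p = s" and ps: "p * s = s"
    by (simp add: s_def mult.assoc ap, simp add: s_def mult.assoc[symmetric] pa)
  define h where "h = p * y * p"
  have sh: "s * h = p"
  proof -
    have "s * h = (s * p) * y * p" by (simp add: h_def mult.assoc)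
    then show ?thesis by (simp add: sp p_def[symmetric] idem)
  qed
  have star_h_s: "star h * s = p"
    using arg_cong[OF sh, of star] by (simp add: star_mult star_s herm)
  have ph: "p * h = h"
    by (simp add: h_def mult.assoc[symmetric] idem)
  \<comment> \<open>The left inverse \<open>h\<^sup>*\<close> and the right inverse \<open>h\<close> of \<open>s\<close> coincide.\<close>
  have star_h: "star h = h"
  proof -
    have "h = (star h * s) * h" by (simp add: star_h_s ph)
    also have "\<dots> = star h * p" by (simp add: mult.assoc sh)
    also have "\<dots> = star (p * h)" by (simp add: star_mult herm)
    finally show ?thesis by (simp add: ph)
  qed
  define b where "b = h * star a"
  have ba: "b * a = p"
    using star_h_s by (simp add: b_def star_h s_def mult.assoc)
  have "a * b * a = a"
    by (simp add: mult.assoc ba ap)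
  moreover have "b * a * b = b"
    unfolding ba by (simp add: b_def mult.assoc[symmetric] ph)
  moreover have "star (a * b) = a * b"
    by (simp add: b_def star_mult star_star star_h mult.assoc)
  moreover have "star (b * a) = b * a"
    by (simp add: ba herm)
  ultimately show ?thesis
    unfolding MP_invertible_def by blast
qed

lemma MP_invertible_if_right_multiple:
  assumes "n > 0" "a * c = a" "right_multiple c ((star a * a) ^ n)"
  shows "a \<in> MP_invertible"
proof -
  obtain x where x: "c = (star a * a) ^ n * x"
    using assms(3) unfolding right_multiple_def by blast
  obtain m where "n = Suc m"
    using assms(1) gr0_conv_Suc by blast
  with x have "c = star a * a * ((star a * a) ^ m * x)"
    by (simp add: mult.assoc)
  with assms(2) show ?thesis
    by (metis MP_invertible_if_gram_cancel)
qed

lemma Hermite_left_multiple_imp_right_multiple: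
  assumes "Hermite v" "left_multiple v d" "star d = d"
  shows "right_multiple v d"
proof -
  obtain x where "v = x * d"
    using assms(2) unfolding left_multiple_def by blast
  then have "v = d * star x"
    using assms(1,3) unfolding Hermite_def by (metis star_mult)
  then show ?thesis
    unfolding right_multiple_def by blast
qed

end

theorem theorem3p5:
  fixes a :: "'a :: involution_ring" and n :: nat
  assumes "n > 0"
  shows
    "(a \<in> MP_invertible \<longleftrightarrow>
        (\<exists>w. projection w \<and> a * w = a \<and> multiple w ((star a * a) ^ n))) \<and>
     (a \<in> MP_invertible \<longleftrightarrow>
        (\<exists>u. Hermite u \<and> a * u = a \<and> right_multiple u ((star a * a) ^ n))) \<and>
     (a \<in> MP_invertible \<longleftrightarrow>
        (\<exists>v. Hermite v \<and> a * v = a \<and> left_multiple v ((star a * a) ^ n))) \<and>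
     (a \<in> MP_invertible \<longleftrightarrow>
        (\<exists>c. a * c = a \<and> right_multiple c ((star a * a) ^ n)))"
proof -
  let ?d = "(star a * a) ^ n"
  have strongest: "\<exists>w. projection w \<and> a * w = a \<and> multiple w ?d" if "a \<in> MP_invertible"
    using MP_invertible_imp_projection_multiple[OF that assms] by blast
  have weakest: "a \<in> MP_invertible" if "a * c = a" "right_multiple c ?d" for c
    using MP_invertible_if_right_multiple[OF assms that] .
  have projection: "Hermite w" if "projection w" for w :: 'a
    using that by (simp add: projection_def Hermite_def)
  have multiple: "left_multiple w ?d" "right_multiple w ?d" if "multiple w ?d" for w
    using that by (auto simp: multiple_def left_multiple_def right_multiple_def)
  have left: "right_multiple v ?d" if "Hermite v" "left_multiple v ?d" for v
    using Hermite_left_multiple_imp_right_multiple[OF that] by (simp add: star_power star_gram)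
  show ?thesis
    using strongest weakest projection multiple left by metis
qed

end
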